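(* Let $k>1$ and $n>k$ be integers and let $j$ be permissible for $(3,n,k)$, i.e. $2k+1\le j\le 2n+1-\left\lceil\frac{n-(k-1)}{k+1}\right\rceil$. Then $$\begin{aligned}F_k(3,n,j)={}&F_k(3,n-1,j)+2F_k(3,n-1,j-1)+F_k(3,n-2,j-2)+F_k(3,n-2,j-3)\\&+\sum_{l=1}^{k-1}F_k(3,n-(l+1),j-2l-1)+\sum_{l=1}^{k-1}F_k(3,n-(l+2),j-2(l+1))\\&+\sum_{l=1}^{k-1}F_k(3,n-(l+2),j-2(l+1)-1).\end{aligned}$$
   Context: An $r$-uniform hypergraph has a vertex set and an edge set, each edge being an $r$-element set of vertices. A loose $r$-path of length $n$ is an $r$-uniform hypergraph (without isolated vertices) with $n$ edges that can be ordered $E_1,\dots,E_n$ so that $|E_i\cap E_j|=1$ if $|i-j|=1$ and $E_i\cap E_j=\emptyset$ if $|i-j|\ge 2$; it has $n(r-1)+1$ vertices. A loose $r$-path of length $0$ is a single vertex. Each vertex is colored red or blue; an edge is blue if all its vertices are blue. A blue subpath of length $k$ means $k$ consecutive edges all of which are blue. $F_k(r,n,j)$ is the number of red/blue colorings of the vertices (vertices are labeled) of a loose $r$-path with $n$ edges having exactly $j$ blue vertices and no blue subpath of length $k$; it is $0$ if $j<0$. *)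

theory Defs
  imports Complex_Main "HOL-Library.FuncSet"
begin

text \<open>The list \<open>Es\<close> enumerates the edges in path order, so \<open>E\<^sub>i\<close> is \<open>Es ! (i - 1)\<close>.
  The requirement \<open>V = \<Union>(set Es)\<close> excludes isolated vertices; the path of length 0 is
  the exceptional case of a single vertex.\<close>

definition loose_path :: "nat \<Rightarrow> 'a set \<Rightarrow> 'a set list \<Rightarrow> bool" where
  "loose_path r V Es \<longleftrightarrow>
     (if Es = [] then card V = 1 else V = \<Union>(set Es)) \<and>
     (\<forall>i < length Es. finite (Es ! i) \<and> card (Es ! i) = r) \<and>
     (\<forall>i < length Es. \<forall>j < length Es.
        (j = i + 1 \<longrightarrow> card (Es ! i \<inter> Es ! j) = 1) \<and>
        (j \<ge> i + 2 \<longrightarrow> Es ! i \<inter> Es ! j = {}))"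

datatype color = Red | Blue

definition blue_vertices :: "'a set \<Rightarrow> ('a \<Rightarrow> color) \<Rightarrow> 'a set" where
  "blue_vertices V c = {v \<in> V. c v = Blue}"

definition blue_edge :: "('a \<Rightarrow> color) \<Rightarrow> 'a set \<Rightarrow> bool" where
  "blue_edge c E \<longleftrightarrow> (\<forall>v \<in> E. c v = Blue)"

definition has_blue_subpath :: "nat \<Rightarrow> 'a set list \<Rightarrow> ('a \<Rightarrow> color) \<Rightarrow> bool" where
  "has_blue_subpath k Es c \<longleftrightarrow>
     (\<exists>i. i + k \<le> length Es \<and> (\<forall>m < k. blue_edge c (Es ! (i + m))))"

definition good_colorings :: "nat \<Rightarrow> 'a set \<Rightarrow> 'a set list \<Rightarrow> int \<Rightarrow> ('a \<Rightarrow> color) set" where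
  "good_colorings k V Es j =
     {c \<in> V \<rightarrow>\<^sub>E UNIV. int (card (blue_vertices V c)) = j \<and> \<not> has_blue_subpath k Es c}"

text \<open>The counts below are taken on one concrete labeled path. The lemma \<open>F_eq_any_loose_path\<close>
  shows that they are the same for every loose path (and every ordering of its edges).\<close>

definition std_vertices :: "nat \<Rightarrow> nat \<Rightarrow> nat set" where
  "std_vertices r n = {0..n * (r - 1)}"

definition std_edges :: "nat \<Rightarrow> nat \<Rightarrow> nat set list" where
  "std_edges r n = map (\<lambda>i. {i * (r - 1)..(i + 1) * (r - 1)}) [0..<n]"

definition F :: "nat \<Rightarrow> nat \<Rightarrow> nat \<Rightarrow> int \<Rightarrow> nat" where
  "F k r n j = card (good_colorings k (std_vertices r n) (std_edges r n) j)"

lemma F_neg: "j < 0 \<Longrightarrow> F k r n j = 0"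
  by (simp add: F_def good_colorings_def)

lemma std_loose_path:
  assumes "2 \<le> r"
  shows "loose_path r (std_vertices r n) (std_edges r n)"
proof -
  obtain d where r: "r = Suc d" and d: "1 \<le> d"
    using assms by (cases r) auto
  have cover: "{0..m * d} = (\<Union>i<m. {i * d..d + i * d})" if "1 \<le> m" for m
    using that
  proof (induction m rule: dec_induct)
    case base
    show ?case by (auto simp: lessThan_Suc)
  next
    case (step m)
    have "{0..Suc m * d} = {0..m * d} \<union> {m * d..d + m * d}" by auto
    then show ?case using step by (auto simp: lessThan_Suc)
  qed
  have meet: "{i * d..d + i * d} \<inter> {d + i * d..d + (d + i * d)} = {d + i * d}" for i
    by auto
  have apart: "{i * d..d + i * d} \<inter> {j * d..d + j * d} = {}" if "i + 2 \<le> j" for i j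
  proof -
    have "(i + 2) * d \<le> j * d" using that by (rule mult_le_mono1)
    then have "d + i * d < j * d" using d by simp
    then show ?thesis by auto
  qed
  show ?thesis
  proof (cases "n = 0")
    case True
    then show ?thesis by (simp add: loose_path_def std_vertices_def std_edges_def)
  next
    case False
    then have V: "{0..n * d} = (\<Union>i<n. {i * d..d + i * d})" by (intro cover) simp
    show ?thesis
      unfolding loose_path_def std_vertices_def std_edges_def
      using False V meet apart by (auto simp: r atLeast0LessThan)
  qed
qed

lemma loose_path_edge: "loose_path r V Es \<Longrightarrow> i < length Es \<Longrightarrow> finite (Es ! i) \<and> card (Es ! i) = r"
  by (simp add: loose_path_def)

lemma loose_path_meet:
  "loose_path r V Es \<Longrightarrow> j < length Es \<Longrightarrow> j = i + 1 \<Longrightarrow> card (Es ! i \<inter> Es ! j) = 1"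
  unfolding loose_path_def by (metis add_lessD1)

lemma loose_path_apart:
  "loose_path r V Es \<Longrightarrow> j < length Es \<Longrightarrow> i + 2 \<le> j \<Longrightarrow> Es ! i \<inter> Es ! j = {}"
  unfolding loose_path_def by (meson add_leE order_le_less_trans)

lemma loose_path_bij:
  assumes "2 \<le> r" and "loose_path r V Es" and "x \<in> V"
    and "Es \<noteq> [] \<Longrightarrow> x \<in> last Es \<and> (\<forall>i < length Es - 1. x \<notin> Es ! i)"
  shows "\<exists>f. bij_betw f {0..length Es * (r - 1)} V \<and> f (length Es * (r - 1)) = x \<and>
           (\<forall>i < length Es. f ` {i * (r - 1)..(i + 1) * (r - 1)} = Es ! i)"
  using assms(2-4)
proof (induction Es arbitrary: V x rule: rev_induct)
  case Nil
  then have "V = {x}" by (auto simp: loose_path_def card_1_singleton_iff)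
  then show ?case by (intro exI[of _ "\<lambda>_. x"]) (auto simp: bij_betw_def)
next
  case (snoc E Es)
  define d where "d = r - 1"
  have d: "1 \<le> d" "r = Suc d" using assms(1) by (auto simp: d_def)
  let ?n = "length Es"
  have fE: "finite E" "card E = r"
    using loose_path_edge[OF snoc.prems(1), of ?n] by simp_all
  have disj: "Es ! i \<inter> E = {}" if "i + 1 < ?n" for i
    using loose_path_apart[OF snoc.prems(1), of ?n i] that by (simp add: nth_append)
  have xE: "x \<in> E" using snoc.prems(3) by simp
  have xi: "x \<notin> Es ! i" if "i < ?n" for i
    using snoc.prems(3) that by (auto simp: nth_append)
  have VE: "V = \<Union>(set Es) \<union> E" using snoc.prems(1) by (auto simp: loose_path_def)
  obtain y W where y: "y \<in> E" "y \<noteq> x" and W: "loose_path r W Es" "y \<in> W"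
    "Es \<noteq> [] \<Longrightarrow> y \<in> last Es \<and> (\<forall>i < ?n - 1. y \<notin> Es ! i)"
    "V = W \<union> E" "W \<inter> E = {y}"
  proof (cases "Es = []")
    case True
    have "E - {x} \<noteq> {}" using fE xE d by (metis card_Diff_singleton card.empty diff_Suc_1 not_one_le_zero)
    then obtain y where "y \<in> E" "y \<noteq> x" by auto
    then show ?thesis using True VE by (intro that[of y "{y}"]) (auto simp: loose_path_def)
  next
    case False
    then have "card ((Es @ [E]) ! (?n - 1) \<inter> (Es @ [E]) ! ?n) = 1"
      by (intro loose_path_meet[OF snoc.prems(1)]) simp_all
    then have "card (last Es \<inter> E) = 1"
      using False by (simp add: nth_append last_conv_nth)
    then obtain y where ly: "last Es \<inter> E = {y}" by (auto simp: card_1_singleton_iff)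
    have lp: "loose_path r (\<Union>(set Es)) Es"
      unfolding loose_path_def
    proof (intro conjI allI impI)
      show "if Es = [] then card (\<Union>(set Es)) = 1 else \<Union>(set Es) = \<Union>(set Es)"
        using False by simp
    next
      fix i assume "i < ?n"
      then show "finite (Es ! i)" "card (Es ! i) = r"
        using loose_path_edge[OF snoc.prems(1), of i] by (simp_all add: nth_append)
    next
      fix i j assume "i < ?n" "j < ?n" "j = i + 1"
      then show "card (Es ! i \<inter> Es ! j) = 1"
        using loose_path_meet[OF snoc.prems(1), of j i] by (simp add: nth_append)
    next
      fix i j assume "i < ?n" "j < ?n" "i + 2 \<le> j"
      then show "Es ! i \<inter> Es ! j = {}"
        using loose_path_apart[OF snoc.prems(1), of j i] by (simp add: nth_append)
    qed
    have "\<Union>(set Es) \<inter> E = {y}"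
    proof (intro equalityI subsetI)
      fix z assume "z \<in> \<Union>(set Es) \<inter> E"
      then obtain i where i: "i < ?n" "z \<in> Es ! i" "z \<in> E"
        by (auto simp: in_set_conv_nth)
      then have "\<not> i + 1 < ?n" using disj by blast
      then have "i = ?n - 1" using i by simp
      then show "z \<in> {y}" using i ly False by (auto simp: last_conv_nth)
    next
      fix z assume "z \<in> {y}"
      then show "z \<in> \<Union>(set Es) \<inter> E" using ly False last_in_set by blast
    qed
    moreover have "x \<notin> last Es" using xi[of "?n - 1"] False by (simp add: last_conv_nth)
    moreover have "y \<notin> Es ! i" if "i < ?n - 1" for i
      using disj[of i] ly that by (auto simp: less_diff_conv)
    ultimately show ?thesis
      using ly lp VE False by (intro that[of y "\<Union>(set Es)"]) auto
  qed
  from snoc.IH[OF W(1-3)] obtain f where f: "bij_betw f {0..?n * d} W" "f (?n * d) = y"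
    "\<And>i. i < ?n \<Longrightarrow> f ` {i * d..d + i * d} = Es ! i"
    by (auto simp: d_def)
  let ?I = "{?n * d<..<d + ?n * d}"
  have "card ?I = card (E - {x, y})"
    using fE y xE d by (simp add: card_Diff_subset)
  then obtain g where g: "bij_betw g ?I (E - {x, y})"
    using fE by (metis finite_Diff finite_greaterThanLessThan finite_same_card_bij)
  define h where "h t = (if t \<le> ?n * d then f t else if t < d + ?n * d then g t else x)" for t
  have h1: "bij_betw h {0..?n * d} W"
    using f(1) by (rule bij_betw_cong[THEN iffD1, rotated]) (simp add: h_def)
  have h2: "bij_betw h ?I (E - {x, y})"
    using g by (rule bij_betw_cong[THEN iffD1, rotated]) (simp add: h_def)
  have h3: "bij_betw h {d + ?n * d} {x}"
    using d by (simp add: bij_betw_def h_def)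
  have "bij_betw h ({0..?n * d} \<union> ?I \<union> {d + ?n * d}) (W \<union> (E - {x, y}) \<union> {x})"
    using W(5) y xE by (intro bij_betw_combine h1 h2 h3) auto
  moreover have "{0..?n * d} \<union> ?I \<union> {d + ?n * d} = {0..d + ?n * d}" using d by auto
  moreover have "W \<union> (E - {x, y}) \<union> {x} = V" using W(2,4) xE y by auto
  ultimately have hV: "bij_betw h {0..d + ?n * d} V" by simp
  have "{?n * d..d + ?n * d} = {?n * d} \<union> ?I \<union> {d + ?n * d}" by auto
  then have "h ` {?n * d..d + ?n * d} = {h (?n * d)} \<union> h ` ?I \<union> {h (d + ?n * d)}" by auto
  also have "\<dots> = {y} \<union> (E - {x, y}) \<union> {x}"
    using h2 h3 f(2) d by (simp add: bij_betw_def h_def)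
  also have "\<dots> = E" using xE y by auto
  finally have hE: "h ` {?n * d..d + ?n * d} = E" .
  have hi: "h ` {i * d..d + i * d} = Es ! i" if "i < ?n" for i
  proof -
    have "d + i * d \<le> ?n * d" using mult_le_mono1[of "Suc i" ?n d] that by simp
    then have "h ` {i * d..d + i * d} = f ` {i * d..d + i * d}"
      by (intro image_cong) (auto simp: h_def)
    then show ?thesis using f(3) that by simp
  qed
  have hx: "h (d + ?n * d) = x" using d by (simp add: h_def)
  show ?case
    using hV hE hi hx
    by (intro exI[of _ h]) (auto simp: d(2) nth_append less_Suc_eq)
qed

lemma good_colorings_transfer:
  assumes f: "bij_betw f V W" and V: "\<And>i. i < length Es \<Longrightarrow> Es ! i \<subseteq> V"
    and len: "length Ds = length Es" and Ds: "\<And>i. i < length Es \<Longrightarrow> f ` (Es ! i) = Ds ! i"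
  shows "card (good_colorings k W Ds j) = card (good_colorings k V Es j)"
proof (rule bij_betw_same_card)
  let ?p = "\<lambda>c. restrict (c \<circ> f) V" and ?q = "\<lambda>c. restrict (c \<circ> inv_into V f) W"
  have inj: "inj_on f V" and img: "f ` V = W" using f by (auto simp: bij_betw_def)
  have blue: "card (blue_vertices V (restrict (c \<circ> f) V)) = card (blue_vertices W c)" for c
  proof -
    have "blue_vertices W c = f ` blue_vertices V (restrict (c \<circ> f) V)"
      using img by (auto simp: blue_vertices_def)
    then show ?thesis
      using inj by (metis (no_types, lifting) blue_vertices_def card_image inj_on_subset mem_Collect_eq subsetI)
  qed
  have sub: "has_blue_subpath k Es (restrict (c \<circ> f) V) = has_blue_subpath k Ds c" for c
  proof -
    have "blue_edge (restrict (c \<circ> f) V) (Es ! i) = blue_edge c (Ds ! i)"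
      if "i < length Es" for i
      using V[OF that] Ds[OF that, symmetric] by (auto simp: blue_edge_def)
    then show ?thesis unfolding has_blue_subpath_def len by (metis add_less_cancel_left order_less_le_trans)
  qed
  have pq: "?p (?q c) = c" if "c \<in> V \<rightarrow>\<^sub>E UNIV" for c :: "'a \<Rightarrow> color"
  proof
    fix v show "?p (?q c) v = c v"
    proof (cases "v \<in> V")
      case True
      then have "f v \<in> W" using img by blast
      then show ?thesis using True inj by simp
    next
      case False
      then show ?thesis using PiE_arb[OF that] by simp
    qed
  qed
  have qp: "?q (?p c) = c" if "c \<in> W \<rightarrow>\<^sub>E UNIV" for c :: "'b \<Rightarrow> color"
  proof
    fix w show "?q (?p c) w = c w"
    proof (cases "w \<in> W")
      case True
      then have "w \<in> f ` V" using img by simp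
      then show ?thesis using True by (simp add: f_inv_into_f inv_into_into)
    next
      case False
      then show ?thesis using PiE_arb[OF that] by simp
    qed
  qed
  show "bij_betw ?p (good_colorings k W Ds j) (good_colorings k V Es j)"
  proof (rule bij_betw_byWitness[where f' = ?q])
    show "\<forall>c \<in> good_colorings k W Ds j. ?q (?p c) = c"
      by (auto simp: good_colorings_def intro!: qp)
    show "\<forall>c \<in> good_colorings k V Es j. ?p (?q c) = c"
      by (auto simp: good_colorings_def intro!: pq)
    show "?p ` good_colorings k W Ds j \<subseteq> good_colorings k V Es j"
      by (auto simp: good_colorings_def blue sub)
    show "?q ` good_colorings k V Es j \<subseteq> good_colorings k W Ds j"
    proof
      fix e assume "e \<in> ?q ` good_colorings k V Es j"
      then obtain c where c: "c \<in> good_colorings k V Es j" and e: "e = ?q c" by blast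
      have "?p e = c" using c pq unfolding e good_colorings_def by blast
      moreover have "e \<in> W \<rightarrow>\<^sub>E UNIV" unfolding e by auto
      ultimately show "e \<in> good_colorings k W Ds j"
        using c blue[of e] sub[of e] unfolding good_colorings_def by simp
    qed
  qed
qed

lemma F_eq_any_loose_path:
  assumes "2 \<le> r" and lp: "loose_path r V Es" and n: "length Es = n"
  shows "F k r n j = card (good_colorings k V Es j)"
proof -
  obtain x where x: "x \<in> V" "Es \<noteq> [] \<Longrightarrow> x \<in> last Es \<and> (\<forall>i < length Es - 1. x \<notin> Es ! i)"
  proof (cases "n \<le> 1")
    case True
    show ?thesis
    proof (cases "Es = []")
      case True
      then show ?thesis using lp that by (auto simp: loose_path_def card_1_singleton_iff)
    next
      case False
      then obtain E where E: "Es = [E]" using True n by (cases Es) auto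
      then have "card E = r" "V = E" using lp by (auto simp: loose_path_def)
      then have "E \<noteq> {}" using assms(1) by auto
      then show ?thesis using that E \<open>V = E\<close> by auto
    qed
  next
    case False
    define A B where "A = Es ! (n - 2)" and "B = Es ! (n - 1)"
    have ne: "Es \<noteq> []" using False n by auto
    then have B: "card B = r" "last Es = B"
      using loose_path_edge[OF lp, of "n - 1"] n False by (simp_all add: B_def last_conv_nth)
    then have BV: "B \<subseteq> V" using lp last_in_set[OF ne] ne by (auto simp: loose_path_def)
    have "card (A \<inter> B) = 1"
      unfolding A_def B_def using False n by (intro loose_path_meet[OF lp]) simp_all
    then have "A \<inter> B \<noteq> B" using B assms(1) by auto
    then obtain x where x: "x \<in> B" "x \<notin> A" by auto
    have "x \<notin> Es ! i" if "i < n - 1" for i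
    proof (cases "i = n - 2")
      case True
      then show ?thesis using x by (simp add: A_def)
    next
      case False
      then have "Es ! i \<inter> B = {}"
        unfolding B_def using that n by (intro loose_path_apart[OF lp]) simp_all
      then show ?thesis using x by auto
    qed
    then show ?thesis using that[of x] x B BV n by auto
  qed
  obtain f where f: "bij_betw f {0..n * (r - 1)} V"
    "\<And>i. i < n \<Longrightarrow> f ` {i * (r - 1)..(i + 1) * (r - 1)} = Es ! i"
    using loose_path_bij[OF assms(1) lp x] n by blast
  have "{i * (r - 1)..(i + 1) * (r - 1)} \<subseteq> {0..n * (r - 1)}" if "i < n" for i
    using mult_le_mono1[of "i + 1" n "r - 1"] that by auto
  then have "card (good_colorings k V Es j) =
      card (good_colorings k (std_vertices r n) (std_edges r n) j)"
    using f n by (intro good_colorings_transfer[where f = f])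
      (auto simp: std_vertices_def std_edges_def simp del: add_mult_distrib)
  then show ?thesis by (simp add: F_def)
qed

end

theory Submission
  imports Defs
begin

text \<open>Classify the good colorings by the position \<open>m\<close> of the first red vertex. Since
  \<open>n \<ge> k\<close>, an initial blue run covering the first \<open>k\<close> edges is forbidden, so
  \<open>m \<le> 2k\<close>. If \<open>m = 2l + 1\<close>, the red vertex is the middle of an edge, and deleting the first
  \<open>l + 1\<close> edges leaves an arbitrary good coloring of the rest. If \<open>m = 2l\<close>, the red vertex is
  a joint (or the first vertex), the color of the vertex \<open>m + 1\<close> is free, and again deleting
  \<open>l + 1\<close> edges leaves an arbitrary good coloring.\<close>

text \<open>Consecutive edges of the standard path are intervals sharing an endpoint, so
  \<open>k\<close> edges in a row fill a single interval of vertices. The case \<open>k = 0\<close>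
  is excluded because the empty subpath is blue in every coloring, whereas the interval would still
  contain one vertex.\<close>

lemma has_blue_subpath_std:
  assumes "0 < k"
  shows "has_blue_subpath k (std_edges r n) c \<longleftrightarrow>
    (\<exists>i. i + k \<le> n \<and> (\<forall>v \<in> {i * (r - 1)..(i + k) * (r - 1)}. c v = Blue))"
proof -
  define d where "d = r - 1"
  have cover: "(\<Union>m<k. {(i + m) * d..(i + m + 1) * d}) = {i * d..(i + k) * d}" for i
    using assms
  proof (induction k rule: nat_induct_non_zero)
    case 1
    show ?case by (simp add: lessThan_Suc)
  next
    case (Suc k)
    have "{i * d..(i + Suc k) * d} = {i * d..(i + k) * d} \<union> {(i + k) * d..(i + k + 1) * d}"
      by (auto simp: algebra_simps)
    then show ?case using Suc by (auto simp: lessThan_Suc)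
  qed
  have "(\<forall>m<k. blue_edge c (std_edges r n ! (i + m))) \<longleftrightarrow>
      (\<forall>v \<in> {i * d..(i + k) * d}. c v = Blue)" if "i + k \<le> n" for i
  proof -
    have "(\<forall>m<k. blue_edge c (std_edges r n ! (i + m))) \<longleftrightarrow>
        (\<forall>m<k. \<forall>v \<in> {(i + m) * d..(i + m + 1) * d}. c v = Blue)"
      using that by (simp add: std_edges_def blue_edge_def d_def)
    also have "\<dots> \<longleftrightarrow> (\<forall>v \<in> (\<Union>m<k. {(i + m) * d..(i + m + 1) * d}). c v = Blue)"
      by blast
    finally show ?thesis unfolding cover .
  qed
  then show ?thesis
    unfolding has_blue_subpath_def d_def[symmetric]
    by (metis (no_types, lifting) length_map length_upt diff_zero std_edges_def)
qed

lemma finite_good_colorings: "finite V \<Longrightarrow> finite (good_colorings k V Es j)"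
proof -
  assume "finite V"
  moreover have "finite (UNIV :: color set)"
    by (rule finite_subset[of _ "{Red, Blue}"]) (use color.exhaust in auto)
  ultimately have "finite (V \<rightarrow>\<^sub>E (UNIV :: color set))"
    by (intro finite_PiE)
  then show ?thesis
    by (rule finite_subset[rotated]) (auto simp: good_colorings_def)
qed

text \<open>The assumption \<open>block\<close> says that the prefix \<open>p\<close>, which omits the last vertex of its
  last edge, already rules out every blue subpath starting in one of the first \<open>a\<close> edges.\<close>

lemma card_good_colorings_prefix:
  assumes k: "0 < k" and a: "a \<le> n"
    and block: "\<And>i. i < a \<Longrightarrow>
      \<exists>v < a * (r - 1). i * (r - 1) \<le> v \<and> v \<le> (i + k) * (r - 1) \<and> p v = Red"
  shows "card {c \<in> good_colorings k (std_vertices r n) (std_edges r n) j.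
        \<forall>v < a * (r - 1). c v = p v} =
      F k r (n - a) (j - int (card {v. v < a * (r - 1) \<and> p v = Blue}))"
proof -
  define d where "d = r - 1"
  define N where "N = (n - a) * d"
  define P where "P = {v. v < a * d \<and> p v = Blue}"
  let ?G = "good_colorings k (std_vertices r n) (std_edges r n) j"
  let ?H = "good_colorings k (std_vertices r (n - a)) (std_edges r (n - a)) (j - int (card P))"
  define run where
    "run M c \<longleftrightarrow> (\<exists>i. i + k \<le> M \<and> (\<forall>v \<in> {i * d..(i + k) * d}. c v = Blue))" for M c
  have nd: "n * d = a * d + N" using a by (simp add: N_def diff_mult_distrib)
  have G: "?G = {c \<in> {0..n * d} \<rightarrow>\<^sub>E UNIV. int (card (blue_vertices {0..n * d} c)) = j \<and>
      \<not> run n c}"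
    by (simp add: run_def good_colorings_def has_blue_subpath_std[OF k] std_vertices_def d_def)
  have H: "?H = {c \<in> {0..N} \<rightarrow>\<^sub>E UNIV. int (card (blue_vertices {0..N} c)) = j - int (card P) \<and>
      \<not> run (n - a) c}"
    by (simp add: run_def good_colorings_def has_blue_subpath_std[OF k] std_vertices_def d_def N_def)
  \<comment> \<open>\<open>f\<close> drops the first \<open>a\<close> edges but keeps the joint
    \<open>a * d\<close>, which becomes vertex 0 of the remaining path; \<open>g\<close> puts the
    prefix \<open>p\<close> back in front. Between colorings with prefix \<open>p\<close> and
    colorings of the remaining path these maps are mutually inverse.\<close>
  define f where "f c = restrict (\<lambda>v. c (v + a * d)) {0..N}" for c :: "nat \<Rightarrow> color"
  define g where "g e v = (if v < a * d then p v else e (v - a * d))" for e :: "nat \<Rightarrow> color" and v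
  have blue: "card (blue_vertices {0..n * d} c) = card P + card (blue_vertices {0..N} (f c))"
    if "\<forall>v < a * d. c v = p v" for c
  proof -
    have "blue_vertices {0..n * d} c = P \<union> (\<lambda>v. v + a * d) ` blue_vertices {0..N} (f c)"
    proof (intro set_eqI)
      fix v
      show "v \<in> blue_vertices {0..n * d} c \<longleftrightarrow>
          v \<in> P \<union> (\<lambda>v. v + a * d) ` blue_vertices {0..N} (f c)"
      proof (cases "v < a * d")
        case True
        then show ?thesis using that by (auto simp: blue_vertices_def P_def nd)
      next
        case False
        then obtain w where "v = w + a * d" by (metis add.commute le_Suc_ex not_less)
        then show ?thesis by (auto simp: blue_vertices_def P_def nd f_def)
      qed
    qed
    moreover have "finite P" by (simp add: P_def)
    moreover have "finite (blue_vertices {0..N} (f c))" by (simp add: blue_vertices_def)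
    moreover have "P \<inter> (\<lambda>v. v + a * d) ` blue_vertices {0..N} (f c) = {}"
      by (auto simp: P_def)
    ultimately show ?thesis
      by (simp add: card_Un_disjoint card_image)
  qed
  have sub: "run n c \<longleftrightarrow> run (n - a) (f c)" if c: "\<forall>v < a * d. c v = p v" for c
  proof
    assume "run n c"
    then obtain i where i: "i + k \<le> n" "\<And>v. v \<in> {i * d..(i + k) * d} \<Longrightarrow> c v = Blue"
      unfolding run_def by blast
    \<comment> \<open>A run starting before edge index \<open>a\<close> would contain the red prefix
      vertex supplied by \<open>block\<close>, so every blue run lies in the part that
      \<open>f\<close> keeps.\<close>
    have "a \<le> i"
    proof (rule ccontr)
      assume "\<not> a \<le> i"
      then show False using block[of i] i(2) c by (force simp: d_def)
    qed
    then obtain s where s: "i = s + a" by (metis add.commute le_Suc_ex)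
    have "f c v = Blue" if "v \<in> {s * d..(s + k) * d}" for v
    proof -
      have "s + k \<le> n - a" using i(1) s by simp
      then have "(s + k) * d \<le> N" unfolding N_def by (rule mult_le_mono1)
      moreover have "c (v + a * d) = Blue"
        using that by (intro i(2)) (auto simp: s algebra_simps)
      ultimately show ?thesis using that by (simp add: f_def)
    qed
    moreover have "s + k \<le> n - a" using i(1) s by simp
    ultimately show "run (n - a) (f c)" unfolding run_def by blast
  next
    assume "run (n - a) (f c)"
    then obtain s where s: "s + k \<le> n - a" "\<And>v. v \<in> {s * d..(s + k) * d} \<Longrightarrow> f c v = Blue"
      unfolding run_def by blast
    have "c v = Blue" if v: "v \<in> {(s + a) * d..(s + a + k) * d}" for v
    proof -
      have "a * d \<le> v" using v by (simp add: algebra_simps)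
      then obtain w where w: "v = w + a * d" by (metis add.commute le_Suc_ex)
      have "(s + k) * d \<le> N" unfolding N_def using s(1) by (rule mult_le_mono1)
      moreover have "w \<in> {s * d..(s + k) * d}" using v w by (auto simp: algebra_simps)
      ultimately show ?thesis using s(2)[of w] w by (simp add: f_def)
    qed
    moreover have "s + a + k \<le> n" using s(1) a by simp
    ultimately show "run n c" unfolding run_def by blast
  qed
  have gp: "\<forall>v < a * d. g e v = p v" for e by (simp add: g_def)
  have fg: "f (g e) = e" if "e \<in> {0..N} \<rightarrow>\<^sub>E UNIV" for e
    using that by (auto simp: f_def g_def restrict_def PiE_def extensional_def fun_eq_iff)
  have gE: "g e \<in> {0..n * d} \<rightarrow>\<^sub>E UNIV" if "e \<in> {0..N} \<rightarrow>\<^sub>E UNIV" for e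
    using that by (auto simp: g_def nd PiE_def extensional_def)
  have gf: "g (f c) = c" if "c \<in> {0..n * d} \<rightarrow>\<^sub>E UNIV" "\<forall>v < a * d. c v = p v" for c
    using that by (auto simp: f_def g_def nd restrict_def PiE_def extensional_def fun_eq_iff)
  have "bij_betw f {c \<in> ?G. \<forall>v < a * d. c v = p v} ?H"
  proof (rule bij_betw_byWitness[where f' = g])
    show "\<forall>c \<in> {c \<in> ?G. \<forall>v < a * d. c v = p v}. g (f c) = c"
      unfolding G using gf by blast
    show "\<forall>e \<in> ?H. f (g e) = e"
      unfolding H using fg by blast
    show "f ` {c \<in> ?G. \<forall>v < a * d. c v = p v} \<subseteq> ?H"
    proof clarify
      fix c assume c: "c \<in> ?G" "\<forall>v < a * d. c v = p v"
      have "f c \<in> {0..N} \<rightarrow>\<^sub>E UNIV" by (simp add: f_def)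
      then show "f c \<in> ?H" using c(1) blue[OF c(2)] sub[OF c(2)] unfolding G H by simp
    qed
    show "g ` ?H \<subseteq> {c \<in> ?G. \<forall>v < a * d. c v = p v}"
    proof clarify
      fix e assume e: "e \<in> ?H"
      then have eE: "e \<in> {0..N} \<rightarrow>\<^sub>E UNIV" unfolding H by blast
      have "g e \<in> ?G"
        using e gE[OF eE] blue[OF gp[of e]] sub[OF gp[of e]] fg[OF eE] unfolding G H by simp
      then show "g e \<in> ?G \<and> (\<forall>v < a * d. g e v = p v)" using gp by blast
    qed
  qed
  from bij_betw_same_card[OF this] show ?thesis
    unfolding F_def d_def[symmetric] P_def[symmetric] .
qed

text \<open>Used to separate the joints (even positions) from the middle vertices of edges (odd
  positions). The largest index \<open>2 * k\<close> is even, so the even sum has one term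
  more.\<close>

lemma sum_atMost_even_odd:
  fixes f :: "nat \<Rightarrow> 'a :: comm_monoid_add"
  shows "(\<Sum>m \<le> 2 * k. f m) = (\<Sum>l \<le> k. f (2 * l)) + (\<Sum>l < k. f (2 * l + 1))"
  by (induction k) (simp_all add: ac_simps)

text \<open>The first sum collects the even positions \<open>2 * l\<close> of the first red vertex,
  with vertex \<open>2 * l + 1\<close> red or blue; the second collects the odd positions
  \<open>2 * l + 1\<close>. What is subtracted from \<open>j\<close> is the number of blue vertices
  deleted. For \<open>l = k\<close> there are \<open>k + 1\<close> edges to delete, which
  \<open>k < n\<close> permits.\<close>

lemma F_3_recursion:
  assumes "0 < k" and "k < n"
  shows "F k 3 n j =
    (\<Sum>l \<le> k. F k 3 (n - (l + 1)) (j - 2 * int l) + F k 3 (n - (l + 1)) (j - 2 * int l - 1))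
    + (\<Sum>l < k. F k 3 (n - (l + 1)) (j - 2 * int l - 1))"
proof -
  let ?G = "good_colorings k (std_vertices 3 n) (std_edges 3 n) j"
  define A where "A m = {c \<in> ?G. c m = Red \<and> (\<forall>v < m. c v = Blue)}" for m
  \<comment> \<open>The prefix with first red vertex \<open>m\<close>; \<open>x\<close> is the color
    of vertex \<open>m + 1\<close> when that vertex is deleted too, which happens for even
    \<open>m\<close>.\<close>
  define p where "p m x v = (if v < m then Blue else if v = m then Red else x)"
    for m :: nat and x and v :: nat
  have finG: "finite ?G" by (intro finite_good_colorings) (simp add: std_vertices_def)
  have "\<exists>m \<le> 2 * k. c \<in> A m" if c: "c \<in> ?G" for c
  proof -
    have "\<not> has_blue_subpath k (std_edges 3 n) c"
      using c by (simp add: good_colorings_def)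
    \<comment> \<open>The instance \<open>i = 0\<close>: the first \<open>k\<close> edges have
      exactly the vertices 0 to \<open>2 * k\<close>.\<close>
    then have "\<not> (0 + k \<le> n \<and> (\<forall>v \<in> {0 * (3 - 1)..(0 + k) * (3 - 1)}. c v = Blue))"
      unfolding has_blue_subpath_std[OF assms(1)] by blast
    then have "\<exists>v \<le> 2 * k. c v \<noteq> Blue"
      using assms(2) by (auto simp: mult.commute)
    then obtain v where v: "v \<le> 2 * k" "c v = Red"
      using color.exhaust by blast
    define m where "m = (LEAST v. c v = Red)"
    have "c m = Red" "m \<le> v" unfolding m_def using v by (auto intro: LeastI Least_le)
    moreover have "c w = Blue" if "w < m" for w
      using not_less_Least[OF that[unfolded m_def]] color.exhaust by blast
    ultimately show ?thesis using v c by (intro exI[of _ m]) (simp add: A_def)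
  qed
  then have "?G = (\<Union>m \<le> 2 * k. A m)" by (fastforce simp: A_def)
  moreover have "A m \<inter> A m' = {}" if "m \<noteq> m'" for m m'
  proof (cases "m < m'")
    case True
    then show ?thesis by (auto simp: A_def)
  next
    case False
    then have "m' < m" using that by simp
    then show ?thesis by (auto simp: A_def)
  qed
  ultimately have "F k 3 n j = (\<Sum>m \<le> 2 * k. card (A m))"
    unfolding F_def using finG by (subst card_UN_disjoint[symmetric]) (auto simp: A_def)
  also have "\<dots> = (\<Sum>l \<le> k. card (A (2 * l))) + (\<Sum>l < k. card (A (2 * l + 1)))"
    by (rule sum_atMost_even_odd)
  also have "(\<Sum>l < k. card (A (2 * l + 1))) =
      (\<Sum>l < k. F k 3 (n - (l + 1)) (j - 2 * int l - 1))"
  proof (intro sum.cong refl)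
    fix l assume "l \<in> {..<k}"
    then have l: "l < k" by simp
    define m where "m = 2 * l + 1"
    \<comment> \<open>The last vertex of the \<open>l + 1\<close> edges stays as the start of the
      remaining path, so the deleted vertices end exactly at the red vertex
      \<open>m\<close>.\<close>
    have m: "(l + 1) * (3 - 1) = Suc m" by (simp add: m_def)
    have "A m = {c \<in> ?G. \<forall>v < Suc m. c v = p m Red v}"
      unfolding A_def p_def by (auto simp: less_Suc_eq)
    also have "card \<dots> =
        F k 3 (n - (l + 1)) (j - int (card {v. v < Suc m \<and> p m Red v = Blue}))"
      unfolding m[symmetric]
    proof (rule card_good_colorings_prefix)
      \<comment> \<open>The witness is the first red vertex: \<open>i \<le> l < k\<close> gives
        \<open>2 * i \<le> m \<le> 2 * (i + k)\<close>.\<close>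
      show "\<exists>v < (l + 1) * (3 - 1). i * (3 - 1) \<le> v \<and> v \<le> (i + k) * (3 - 1) \<and>
        p m Red v = Red" if "i < l + 1" for i
        unfolding m using that l by (intro exI[of _ m]) (simp add: p_def m_def)
    qed (use assms l in auto)
    also have "{v. v < Suc m \<and> p m Red v = Blue} = {..<m}"
      by (auto simp: p_def split: if_splits)
    finally show "card (A (2 * l + 1)) = F k 3 (n - (l + 1)) (j - 2 * int l - 1)"
      by (simp add: m_def algebra_simps)
  qed
  also have "(\<Sum>l \<le> k. card (A (2 * l))) =
    (\<Sum>l \<le> k. F k 3 (n - (l + 1)) (j - 2 * int l) + F k 3 (n - (l + 1)) (j - 2 * int l - 1))"
  proof (intro sum.cong refl)
    fix l assume "l \<in> {..k}"
    then have l: "l \<le> k" by simp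
    define m where "m = 2 * l"
    \<comment> \<open>Here the deleted part reaches one vertex beyond \<open>m\<close>, so the
      colorings are split by the color of \<open>Suc m\<close>.\<close>
    have m: "(l + 1) * (3 - 1) = Suc (Suc m)" by (simp add: m_def)
    define B where "B x = {c \<in> ?G. \<forall>v < Suc (Suc m). c v = p m x v}" for x
    have B: "B x = {c \<in> A m. c (Suc m) = x}" for x
      unfolding A_def B_def p_def by (auto simp: less_Suc_eq)
    have "A m = B Red \<union> B Blue"
      unfolding B using color.exhaust by blast
    moreover have "B Red \<inter> B Blue = {}"
      unfolding B by auto
    moreover have "finite (B x)" for x using finG by (simp add: B_def)
    ultimately have "card (A m) = card (B Red) + card (B Blue)"
      by (simp add: card_Un_disjoint)
    moreover have "card (B x) =
        F k 3 (n - (l + 1)) (j - int (card {v. v < Suc (Suc m) \<and> p m x v = Blue}))" for x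
      unfolding B_def m[symmetric]
    proof (rule card_good_colorings_prefix)
      \<comment> \<open>The extreme case is \<open>l = k\<close>, \<open>i = 0\<close>, where the
        red vertex \<open>m = 2 * k\<close> is the last vertex of the run to be blocked.\<close>
      show "\<exists>v < (l + 1) * (3 - 1). i * (3 - 1) \<le> v \<and> v \<le> (i + k) * (3 - 1) \<and>
        p m x v = Red" if "i < l + 1" for i
        unfolding m using that l by (intro exI[of _ m]) (simp add: p_def m_def)
    qed (use assms l in auto)
    moreover have "{v. v < Suc (Suc m) \<and> p m Red v = Blue} = {..<m}"
      by (auto simp: p_def split: if_splits)
    moreover have "{v. v < Suc (Suc m) \<and> p m Blue v = Blue} = insert (Suc m) {..<m}"
      by (auto simp: p_def split: if_splits)
    ultimately show "card (A (2 * l)) =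
        F k 3 (n - (l + 1)) (j - 2 * int l) + F k 3 (n - (l + 1)) (j - 2 * int l - 1)"
      by (simp add: m_def algebra_simps)
  qed
  finally show ?thesis .
qed

theorem theorem3p9:
  fixes k n :: nat and j :: int
  assumes "1 < k" and "k < n"
    and "2 * int k + 1 \<le> j"
    and "j \<le> 2 * int n + 1 - \<lceil>(real n - (real k - 1)) / (real k + 1)\<rceil>"
  shows "F k 3 n j =
      F k 3 (n - 1) j + 2 * F k 3 (n - 1) (j - 1)
      + F k 3 (n - 2) (j - 2) + F k 3 (n - 2) (j - 3)
      + (\<Sum>l = 1..k - 1. F k 3 (n - (l + 1)) (j - 2 * int l - 1))
      + (\<Sum>l = 1..k - 1. F k 3 (n - (l + 2)) (j - 2 * (int l + 1)))
      + (\<Sum>l = 1..k - 1. F k 3 (n - (l + 2)) (j - 2 * (int l + 1) - 1))"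
proof -
  obtain q where q: "k = Suc q" using assms(1) by (cases k) auto
  \<comment> \<open>The term \<open>l = 0\<close> split off here joins an equal one from the even
    sum, which gives the coefficient 2.\<close>
  have odd: "(\<Sum>l < k. F k 3 (n - (l + 1)) (j - 2 * int l - 1)) =
      F k 3 (n - 1) (j - 1) + (\<Sum>l = 1..k - 1. F k 3 (n - (l + 1)) (j - 2 * int l - 1))"
    unfolding q by (subst sum.lessThan_Suc_shift) (simp add: sum.atLeast1_atMost_eq)
  \<comment> \<open>The terms 0 and 1 yield the isolated summands for \<open>n - 1\<close> and
    \<open>n - 2\<close>; shifting the index of the others by one turns \<open>n - (l + 1)\<close>
    into \<open>n - (l + 2)\<close>.\<close>
  have even: "(\<Sum>l \<le> k. f l) = f 0 + f 1 + (\<Sum>l = 1..k - 1. f (l + 1))" for f :: "nat \<Rightarrow> nat"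
    unfolding q by (simp add: sum.atMost_Suc_shift lessThan_Suc_atMost[symmetric] sum.lessThan_Suc_shift
      sum.atLeast1_atMost_eq del: sum.lessThan_Suc sum.atMost_Suc)
  show ?thesis
    using F_3_recursion[of k n j] assms(1,2) unfolding odd even
    by (simp add: sum.distrib algebra_simps numeral_2_eq_2)
qed

end
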